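(* Let a moving quadrilateral mesh $\{I_{i,j}(\tau)\}$, evolved geometric moments $\widetilde{\mathcal M}_{s,r,i,j}$ and integrated variables $\mathbf V_{i,j}\in\mathbb R^m$ be as in the context, with a 2-exact reconstruction, and let the semi-discrete system $\frac{\mathrm d}{\mathrm d\tau}\widetilde{\mathcal M}_{s,r,i,j}=\mathcal L^{\widetilde{\mathcal M}_{s,r}}_{i,j}(I_{i,j})$, $\frac{\mathrm d}{\mathrm d\tau}\mathbf V_{i,j}=\mathcal L^{\mathbf V}_{i,j}(\widetilde{\mathcal M},\mathbf V,I_{i,j})$ be advanced from $\tau^\ell$ to $\tau^{\ell+1}=\tau^\ell+\Delta\tau$ by one step of the SSPRK3 method. Suppose that at $\tau^\ell$ there are constant vectors $\mathbf c_{s,r}\in\mathbb R^m$ ($s+r\le2$) such that $$\mathbf V^\ell_{i,j}=\sum_{s+r\le2}\mathbf c_{s,r}\,\widetilde{\mathcal M}^\ell_{s,r,i,j}\quad\text{for all } i,j .$$ Then, with the same coefficients, $$\mathbf V^{\ell+1}_{i,j}=\sum_{s+r\le2}\mathbf c_{s,r}\,\widetilde{\mathcal M}^{\ell+1}_{s,r,i,j}\quad\text{for all } i,j .$$ Consequently, the updated cell averages satisfy $\mathbf V^{\ell+1}_{i,j}/\widetilde{\mathcal M}^{\ell+1}_{0,0,i,j}=\bigl(\widetilde{\mathcal M}^{\ell+1}_{0,0,i,j}\bigr)^{-1}\sum_{s+r\le2}\mathbf c_{s,r}\widetilde{\mathcal M}^{\ell+1}_{s,r,i,j}$, i.e. they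 are the averages of $\mathbf p(x,y)=\sum_{s+r\le2}\mathbf c_{s,r}x^sy^r$ in the sense of integration with the evolved geometric moments, and any 2-exact reconstruction based on $\{\widetilde{\mathcal M}^{\ell+1}_{s,r},\mathbf V^{\ell+1}/\widetilde{\mathcal M}^{\ell+1}_{0,0}\}$ exactly recovers $\mathbf p$.
   Context: Mesh. $\{I_{i,j}(\tau)\}_{1\le i\le N_x,1\le j\le N_y}$ is a logically rectangular conforming mesh of quadrilaterals (neighbouring cells share a full edge and its vertices) whose vertices move as $\mathbf x_P(\tau)=\mathbf x_P^n+\tau\mathbf w_P$ with constant $\mathbf w_P\in\mathbb R^2$. Mesh regularity: at every $\tau$ each cell has pairwise distinct, strictly counterclockwise ordered vertices $A,B,C,D$ and is a (nondegenerate) convex quadrilateral. Edges $l^1_{i,j}=AB$, $l^2_{i,j}=BC$, $l^3_{i,j}=CD$, $l^4_{i,j}=DA$ have lengths $|l^k_{i,j}|$ and outward unit normals $\mathbf n_k$. Three-point Gauss--Lobatto points on edge $k$: $\mathbf x_{k,g}=(x_{k,g},y_{k,g})$, $g=1,2,3$ (first endpoint, midpoint, second endpoint), weights $\omega_1=\omega_3=\frac16$, $\omega_2=\frac23$; $\mathbf w_{k,g}$ is the linear interpolation along the edge of the endpoint velocities. Evolved geometric moments (EGMs) $\widetilde{\mathcal M}_{s,r,i,j}\in\mathbb R$, $s,r\in\mathbb N_0$, $s+r\le2$, are numerical approximations of $\int_{I_{i,j}}x^sy^r\,\mathrm dx\,\mathrm dy$; $\mathbf V_{i,j}\in\mathbb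 R^m$ are cell-integrated conserved variables; cell averages are $\overline{\mathbf U}_{i,j}=\mathbf V_{i,j}/\widetilde{\mathcal M}_{0,0,i,j}$ ($\widetilde{\mathcal M}_{0,0,i,j}\ne0$ at all levels and stages). Reconstruction. Given mesh geometry, EGMs and cell averages, the reconstruction assigns to each cell a function $\mathbf U_h:\mathbb R^2\to\mathbb R^m$ depending on the averages and EGMs in a stencil of that cell. It is 2-exact for the given mesh geometry and EGMs if for every target cell: whenever on its stencil $\overline{\mathbf U}_{i,j}=\widetilde{\mathcal M}_{0,0,i,j}^{-1}\sum_{s+r\le2}\mathbf c_{s,r}\widetilde{\mathcal M}_{s,r,i,j}$ for some $\mathbf c_{s,r}\in\mathbb R^m$, then $\mathbf U_h(x,y)=\sum_{s+r\le2}\mathbf c_{s,r}x^sy^r$ at every $(x,y)$. The reconstruction is assumed 2-exact for the geometry and EGMs at every stage. $\mathbf U^{\mathrm{int}}_{k,g},\mathbf U^{\mathrm{ext}}_{k,g}$ are the values at $\mathbf x_{k,g}$ of the reconstructions in the cell itself and in the neighbour across edge $k$. On boundary edges, the exterior state is consistent: whenever there is one polynomial $\mathbf p(x,y)=\sum_{s+r\le2}\mathbf c_{s,r}x^sy^r$, $\mathbf c_{s,r}\in\mathbb R^m$, such that $\overline{\mathbf U}_{i,j}=\widetilde{\mathcal M}_{0,0,i,j}^{-1}\sum_{s+r\le2}\mathbf c_{s,r}\widetilde{\mathcal M}_{s,r,i,j}$ in all cells, $\mathbf U^{\mathrm{ext}}_{k,g}=\mathbf p(\mathbf x_{k,g})$.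 Operators. $$\mathcal L^{\widetilde{\mathcal M}_{s,r}}_{i,j}(I_{i,j})=\sum_{k=1}^4|l^k_{i,j}|\sum_{g=1}^3\omega_g\,x_{k,g}^sy_{k,g}^r\,(\mathbf w_{k,g}\cdot\mathbf n_k),\qquad \mathcal L^{\mathbf V}_{i,j}(\widetilde{\mathcal M},\mathbf V,I_{i,j})=-\sum_{k=1}^4|l^k_{i,j}|\sum_{g=1}^3\omega_g\,\widehat{\mathbf G}_{k,g},$$ $$\widehat{\mathbf G}_{k,g}=\tfrac12\bigl[\mathbf G(\mathbf U^{\mathrm{int}}_{k,g},\mathbf w_{k,g})\cdot\mathbf n_k+\mathbf G(\mathbf U^{\mathrm{ext}}_{k,g},\mathbf w_{k,g})\cdot\mathbf n_k-a^{\max}_{i,j,k}(\mathbf U^{\mathrm{ext}}_{k,g}-\mathbf U^{\mathrm{int}}_{k,g})\bigr],$$ with $\mathbf G(\mathbf U,\mathbf w)=-\mathbf U\otimes\mathbf w$ and $a^{\max}_{i,j,k}=\max_g|\mathbf w_{k,g}\cdot\mathbf n_k|$. SSPRK3 step (applied simultaneously to all $\widetilde{\mathcal M}_{s,r,i,j}$ and $\mathbf V_{i,j}$): $(\cdot)^{(1)}=(\cdot)^\ell+\Delta\tau\,\mathcal L(\widetilde{\mathcal M}^\ell,\mathbf V^\ell,I^\ell)$; $(\cdot)^{(2)}=\frac34(\cdot)^\ell+\frac14[(\cdot)^{(1)}+\Delta\tau\,\mathcal L(\widetilde{\mathcal M}^{(1)},\mathbf V^{(1)},I^{(1)})]$;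 $(\cdot)^{\ell+1}=\frac13(\cdot)^\ell+\frac23[(\cdot)^{(2)}+\Delta\tau\,\mathcal L(\widetilde{\mathcal M}^{(2)},\mathbf V^{(2)},I^{(2)})]$, where $I^\ell=I(\tau^\ell)$, $I^{(1)}=I(\tau^\ell+\Delta\tau)$, $I^{(2)}=I(\tau^\ell+\tfrac12\Delta\tau)$. *)

theory Defs
  imports "HOL-Analysis.Analysis"
begin

text \<open>
  Mesh cells are indexed by \<open>(i, j)\<close> with \<open>1 \<le> i \<le> Nx\<close>, \<open>1 \<le> j \<le> Ny\<close>, mesh nodes by
  \<open>(a, b)\<close> with \<open>0 \<le> a \<le> Nx\<close>, \<open>0 \<le> b \<le> Ny\<close>.  Conformity of the mesh is built in: adjacent cells
  refer to the same two nodes.  Only the values of the functions below at indices in these ranges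
  (and, for moments, at \<open>s + r \<le> 2\<close>) carry meaning.
\<close>

type_synonym cell = "nat \<times> nat"
type_synonym node = "nat \<times> nat"
type_synonym geometry = "node \<Rightarrow> real ^ 2"
type_synonym moments = "nat \<Rightarrow> nat \<Rightarrow> cell \<Rightarrow> real"

text \<open>
  A reconstruction maps mesh geometry, moments and cell averages to one function per cell.
\<close>

type_synonym 'm reconstruction =
  "geometry \<Rightarrow> moments \<Rightarrow> (cell \<Rightarrow> real ^ 'm) \<Rightarrow> cell \<Rightarrow> real ^ 2 \<Rightarrow> real ^ 'm"

text \<open>
  Exterior states on boundary edges; the last three arguments are the cell, the edge \<open>k\<close>
  and the Gauss--Lobatto index \<open>g\<close>.
\<close>

type_synonym 'm exterior =
  "geometry \<Rightarrow> moments \<Rightarrow> (cell \<Rightarrow> real ^ 'm) \<Rightarrow> cell \<Rightarrow> nat \<Rightarrow> nat \<Rightarrow> real ^ 'm"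

definition cells :: "nat \<Rightarrow> nat \<Rightarrow> cell set" where
  "cells Nx Ny = {1..Nx} \<times> {1..Ny}"

text \<open>The nodes \<open>A, B, C, D\<close> of a cell; edge \<open>k\<close> (\<open>k = 1, ..., 4\<close>) is \<open>AB\<close>, \<open>BC\<close>, \<open>CD\<close>, \<open>DA\<close>.\<close>

fun corners :: "cell \<Rightarrow> node list" where
  "corners (i, j) = [(i - 1, j - 1), (i, j - 1), (i, j), (i - 1, j)]"

definition edge_start :: "cell \<Rightarrow> nat \<Rightarrow> node" where
  "edge_start c k = corners c ! (k - 1)"

definition edge_end :: "cell \<Rightarrow> nat \<Rightarrow> node" where
  "edge_end c k = corners c ! (k mod 4)"

text \<open>
  The index across edge \<open>k\<close>.  It lies outside \<open>cells Nx Ny\<close> exactly for boundary edges.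
\<close>

fun neighbour :: "cell \<Rightarrow> nat \<Rightarrow> cell" where
  "neighbour (i, j) k = [(i, j - 1), (i + 1, j), (i, j + 1), (i - 1, j)] ! (k - 1)"


section \<open>Geometry of the moving mesh\<close>

definition moving_nodes :: "geometry \<Rightarrow> geometry \<Rightarrow> real \<Rightarrow> geometry" where
  "moving_nodes x\<^sub>n w \<tau> P = x\<^sub>n P + \<tau> *\<^sub>R w P"

text \<open>Twice the signed area of the triangle \<open>P Q R\<close>; positive iff \<open>R\<close> lies strictly left of \<open>P Q\<close>.\<close>

definition orient :: "real ^ 2 \<Rightarrow> real ^ 2 \<Rightarrow> real ^ 2 \<Rightarrow> real" where
  "orient P Q R = (Q $ 1 - P $ 1) * (R $ 2 - P $ 2) - (Q $ 2 - P $ 2) * (R $ 1 - P $ 1)"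

text \<open>
  As \<open>orient\<close> is invariant under cyclic permutations, the four inequalities say that for each
  directed edge both other vertices lie strictly to its left, i.e. that \<open>A B C D\<close> is a
  nondegenerate, counterclockwise convex quadrilateral.
\<close>

definition ccw_convex_quad :: "real ^ 2 \<Rightarrow> real ^ 2 \<Rightarrow> real ^ 2 \<Rightarrow> real ^ 2 \<Rightarrow> bool" where
  "ccw_convex_quad A B C D \<longleftrightarrow> distinct [A, B, C, D] \<and>
     0 < orient A B C \<and> 0 < orient B C D \<and> 0 < orient C D A \<and> 0 < orient D A B"

definition regular_mesh :: "nat \<Rightarrow> nat \<Rightarrow> geometry \<Rightarrow> bool" where
  "regular_mesh Nx Ny X \<longleftrightarrow> (\<forall>c \<in> cells Nx Ny.
     ccw_convex_quad (X (edge_start c 1)) (X (edge_start c 2))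
                     (X (edge_start c 3)) (X (edge_start c 4)))"

definition edge_length :: "geometry \<Rightarrow> cell \<Rightarrow> nat \<Rightarrow> real" where
  "edge_length X c k = dist (X (edge_start c k)) (X (edge_end c k))"

text \<open>
  The unit tangent of the counterclockwise edge, rotated clockwise by a right angle;
  see \<open>outer_normal_outward\<close> below.
\<close>

definition outer_normal :: "geometry \<Rightarrow> cell \<Rightarrow> nat \<Rightarrow> real ^ 2" where
  "outer_normal X c k =
     (let d = X (edge_end c k) - X (edge_start c k)
      in vector [d $ 2, - (d $ 1)] /\<^sub>R edge_length X c k)"

definition gl_weight :: "nat \<Rightarrow> real" where
  "gl_weight g = [1/6, 2/3, 1/6] ! (g - 1)"

text \<open>
  Linear interpolation of nodal data at the three Gauss--Lobatto points of edge \<open>k\<close>; applied to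
  the node positions it yields the points \<open>x\<^sub>k\<^sub>g\<close>, applied to the node velocities it yields \<open>w\<^sub>k\<^sub>g\<close>.
\<close>

definition at_gl :: "(node \<Rightarrow> real ^ 2) \<Rightarrow> cell \<Rightarrow> nat \<Rightarrow> nat \<Rightarrow> real ^ 2" where
  "at_gl f c k g =
     (let \<theta> = [0, 1/2, 1] ! (g - 1)
      in (1 - \<theta>) *\<^sub>R f (edge_start c k) + \<theta> *\<^sub>R f (edge_end c k))"


section \<open>Polynomials, moments and reconstruction\<close>

definition quad_poly :: "(nat \<Rightarrow> nat \<Rightarrow> real ^ 'm) \<Rightarrow> real ^ 2 \<Rightarrow> real ^ 'm" where
  "quad_poly cf x = (\<Sum>(s, r) \<in> {(s, r). s + r \<le> 2}. ((x $ 1) ^ s * (x $ 2) ^ r) *\<^sub>R cf s r)"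

definition moment_integral ::
    "(nat \<Rightarrow> nat \<Rightarrow> real ^ 'm) \<Rightarrow> moments \<Rightarrow> cell \<Rightarrow> real ^ 'm" where
  "moment_integral cf M c = (\<Sum>(s, r) \<in> {(s, r). s + r \<le> 2}. M s r c *\<^sub>R cf s r)"

definition moment_average ::
    "(nat \<Rightarrow> nat \<Rightarrow> real ^ 'm) \<Rightarrow> moments \<Rightarrow> cell \<Rightarrow> real ^ 'm" where
  "moment_average cf M c = inverse (M 0 0 c) *\<^sub>R moment_integral cf M c"

definition cell_average :: "moments \<Rightarrow> (cell \<Rightarrow> real ^ 'm) \<Rightarrow> cell \<Rightarrow> real ^ 'm" where
  "cell_average M V c = V c /\<^sub>R M 0 0 c"

text \<open>\<open>R\<close> only uses the averages and the moments (of order at most two) in the stencil \<open>St c\<close>.\<close>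

definition has_stencils ::
    "nat \<Rightarrow> nat \<Rightarrow> (cell \<Rightarrow> cell set) \<Rightarrow> ('m :: finite) reconstruction \<Rightarrow> bool" where
  "has_stencils Nx Ny St R \<longleftrightarrow> (\<forall>c \<in> cells Nx Ny. St c \<subseteq> cells Nx Ny \<and>
     (\<forall>X M M' U U'.
        (\<forall>d \<in> St c. U d = U' d \<and> (\<forall>s r. s + r \<le> 2 \<longrightarrow> M s r d = M' s r d))
        \<longrightarrow> R X M U c = R X M' U' c))"

definition two_exact ::
    "nat \<Rightarrow> nat \<Rightarrow> (cell \<Rightarrow> cell set) \<Rightarrow> ('m :: finite) reconstruction \<Rightarrow> geometry \<Rightarrow> moments \<Rightarrow> bool" where
  "two_exact Nx Ny St R X M \<longleftrightarrow> (\<forall>c \<in> cells Nx Ny. \<forall>U cf.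
     (\<forall>d \<in> St c. U d = moment_average cf M d) \<longrightarrow> (\<forall>x. R X M U c x = quad_poly cf x))"

definition consistent_exterior ::
    "nat \<Rightarrow> nat \<Rightarrow> ('m :: finite) exterior \<Rightarrow> geometry \<Rightarrow> moments \<Rightarrow> (cell \<Rightarrow> real ^ 'm) \<Rightarrow> bool" where
  "consistent_exterior Nx Ny E X M U \<longleftrightarrow> (\<forall>cf.
     (\<forall>d \<in> cells Nx Ny. U d = moment_average cf M d) \<longrightarrow>
     (\<forall>c \<in> cells Nx Ny. \<forall>k \<in> {1..4}. \<forall>g \<in> {1..3}. neighbour c k \<notin> cells Nx Ny \<longrightarrow>
        E X M U c k g = quad_poly cf (at_gl X c k g)))"


section \<open>Spatial operators and time stepping\<close>

definition L_moment :: "geometry \<Rightarrow> geometry \<Rightarrow> nat \<Rightarrow> nat \<Rightarrow> cell \<Rightarrow> real" where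
  "L_moment w X s r c =
     (\<Sum>k = 1..4. edge_length X c k *
       (\<Sum>g = 1..3. gl_weight g * (at_gl X c k g $ 1) ^ s * (at_gl X c k g $ 2) ^ r
                     * (at_gl w c k g \<bullet> outer_normal X c k)))"

text \<open>\<open>geo_flux U w\<close> is the matrix \<open>- U \<otimes> w\<close>.\<close>

definition geo_flux :: "real ^ 'm \<Rightarrow> real ^ 2 \<Rightarrow> real ^ 2 ^ 'm" where
  "geo_flux U w = (\<chi> i l. - (U $ i * w $ l))"

definition U_int ::
    "('m :: finite) reconstruction \<Rightarrow> geometry \<Rightarrow> moments \<Rightarrow> (cell \<Rightarrow> real ^ 'm) \<Rightarrow> cell \<Rightarrow> nat \<Rightarrow> nat \<Rightarrow> real ^ 'm"
  where "U_int R X M U c k g = R X M U c (at_gl X c k g)"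

definition U_ext ::
    "nat \<Rightarrow> nat \<Rightarrow> ('m :: finite) reconstruction \<Rightarrow> ('m :: finite) exterior \<Rightarrow> geometry \<Rightarrow> moments \<Rightarrow> (cell \<Rightarrow> real ^ 'm)
     \<Rightarrow> cell \<Rightarrow> nat \<Rightarrow> nat \<Rightarrow> real ^ 'm" where
  "U_ext Nx Ny R E X M U c k g =
     (if neighbour c k \<in> cells Nx Ny then R X M U (neighbour c k) (at_gl X c k g)
      else E X M U c k g)"

definition a_max :: "geometry \<Rightarrow> geometry \<Rightarrow> cell \<Rightarrow> nat \<Rightarrow> real" where
  "a_max w X c k = Max ((\<lambda>g. \<bar>at_gl w c k g \<bullet> outer_normal X c k\<bar>) ` {1..3})"

definition num_flux ::
    "geometry \<Rightarrow> geometry \<Rightarrow> cell \<Rightarrow> nat \<Rightarrow> nat \<Rightarrow> real ^ 'm \<Rightarrow> real ^ 'm \<Rightarrow> real ^ 'm" where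
  "num_flux w X c k g Ui Ue =
     (1/2) *\<^sub>R (geo_flux Ui (at_gl w c k g) *v outer_normal X c k
              + geo_flux Ue (at_gl w c k g) *v outer_normal X c k
              - a_max w X c k *\<^sub>R (Ue - Ui))"

definition L_V ::
    "nat \<Rightarrow> nat \<Rightarrow> ('m :: finite) reconstruction \<Rightarrow> ('m :: finite) exterior \<Rightarrow> geometry \<Rightarrow> geometry \<Rightarrow> moments
     \<Rightarrow> (cell \<Rightarrow> real ^ 'm) \<Rightarrow> cell \<Rightarrow> real ^ 'm" where
  "L_V Nx Ny R E w X M V c =
     (let U = cell_average M V in
      - (\<Sum>k = 1..4. edge_length X c k *\<^sub>R
          (\<Sum>g = 1..3. gl_weight g *\<^sub>R
             num_flux w X c k g (U_int R X M U c k g) (U_ext Nx Ny R E X M U c k g))))"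

text \<open>
  \<open>u0\<close>, \<open>u1\<close>, \<open>u2\<close>, \<open>u3\<close> are the values at \<open>\<tau>\<^sup>l\<close>, in the two stages and at \<open>\<tau>\<^sup>l + \<Delta>\<tau>\<close>; \<open>L0\<close>, \<open>L1\<close>,
  \<open>L2\<close> are the values of the right-hand side at the first three of them.
\<close>

definition ssprk3 ::
    "real \<Rightarrow> 'a :: real_vector \<Rightarrow> 'a \<Rightarrow> 'a \<Rightarrow> 'a \<Rightarrow> 'a \<Rightarrow> 'a \<Rightarrow> 'a \<Rightarrow> bool" where
  "ssprk3 dt u0 u1 u2 u3 L0 L1 L2 \<longleftrightarrow>
     u1 = u0 + dt *\<^sub>R L0 \<and>
     u2 = (3/4) *\<^sub>R u0 + (1/4) *\<^sub>R (u1 + dt *\<^sub>R L1) \<and>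
     u3 = (1/3) *\<^sub>R u0 + (2/3) *\<^sub>R (u2 + dt *\<^sub>R L2)"


section \<open>The normals point outward\<close>

lemma finite_quad_indices: "finite {(s :: nat, r :: nat). s + r \<le> 2}"
  by (rule finite_subset[of _ "{..2} \<times> {..2}"]) auto

lemma edge_index_cases: "k \<in> {1..4} \<Longrightarrow> k = 1 \<or> k = 2 \<or> k = 3 \<or> k = (4 :: nat)"
  by auto

lemma edge_simps:
  "edge_start (i, j) 1 = (i - 1, j - 1)" "edge_end (i, j) 1 = (i, j - 1)"
  "edge_start (i, j) 2 = (i, j - 1)" "edge_end (i, j) 2 = (i, j)"
  "edge_start (i, j) 3 = (i, j)" "edge_end (i, j) 3 = (i - 1, j)"
  "edge_start (i, j) 4 = (i - 1, j)" "edge_end (i, j) 4 = (i - 1, j - 1)"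
  by (simp_all add: edge_start_def edge_end_def nth_Cons')

lemma orient_degenerate: "orient P Q P = 0" "orient P Q Q = 0"
  by (simp_all add: orient_def)

lemma orient_rotate: "orient P Q R = orient Q R P"
  by (simp add: orient_def algebra_simps)

lemma outer_normal_outward:
  assumes "regular_mesh Nx Ny X" "c \<in> cells Nx Ny" "k \<in> {1..4}"
  shows "norm (outer_normal X c k) = 1"
    and "outer_normal X c k \<bullet> (X (edge_end c k) - X (edge_start c k)) = 0"
    and "x \<in> convex hull (X ` set (corners c)) \<Longrightarrow>
           outer_normal X c k \<bullet> (x - X (edge_start c k)) \<le> 0"
proof -
  let ?P = "X (edge_start c k)" and ?Q = "X (edge_end c k)"
  obtain i j where c: "c = (i, j)" by (cases c)
  define A B C D where ABCD: "A = X (i - 1, j - 1)" "B = X (i, j - 1)" "C = X (i, j)"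
    "D = X (i - 1, j)"
  have reg: "ccw_convex_quad A B C D"
    using bspec[OF assms(1)[unfolded regular_mesh_def] assms(2)]
    unfolding c edge_simps ABCD .
  then have pos: "0 < orient A B C" "0 < orient B C D" "0 < orient C D A" "0 < orient D A B"
    and dist: "A \<noteq> B" "B \<noteq> C" "C \<noteq> D" "D \<noteq> A"
    by (auto simp: ccw_convex_quad_def)
  have pos': "0 < orient A B D" "0 < orient B C A" "0 < orient C D B" "0 < orient D A C"
    using pos orient_rotate by metis+
  have PQ: "(?P, ?Q) \<in> {(A, B), (B, C), (C, D), (D, A)}"
    using edge_index_cases[OF assms(3)] by (elim disjE) (simp_all only: c edge_simps ABCD, simp_all)
  have ne: "?P \<noteq> ?Q"
    using PQ dist by auto
  have left: "0 \<le> orient ?P ?Q z" if z: "z \<in> X ` set (corners c)" for z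
  proof -
    have "z \<in> {A, B, C, D}"
      using z by (simp only: c corners.simps ABCD) simp
    then show ?thesis
      using PQ pos pos' by (auto simp: orient_degenerate intro: less_imp_le)
  qed
  have len: "edge_length X c k > 0" using ne by (simp add: edge_length_def)
  have inner: "outer_normal X c k \<bullet> (z - ?P) = - orient ?P ?Q z / edge_length X c k" for z
    using len by (simp add: outer_normal_def Let_def inner_vec_def sum_2 orient_def divide_simps)
      (simp add: algebra_simps)
  have "norm (vector [(?Q - ?P) $ 2, - ((?Q - ?P) $ 1)] :: real ^ 2) = edge_length X c k"
    by (simp add: edge_length_def dist_norm norm_vec_def L2_set_def sum_2 add.commute
        power2_commute)
  then show "norm (outer_normal X c k) = 1"
    using len by (simp add: outer_normal_def Let_def)
  show "outer_normal X c k \<bullet> (?Q - ?P) = 0"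
    unfolding inner by (simp add: orient_def algebra_simps)
  assume x: "x \<in> convex hull (X ` set (corners c))"
  have "X ` set (corners c) \<subseteq> {z. outer_normal X c k \<bullet> z \<le> outer_normal X c k \<bullet> ?P}"
  proof
    fix z assume "z \<in> X ` set (corners c)"
    then have "outer_normal X c k \<bullet> (z - ?P) \<le> 0"
      unfolding inner using left len by (auto simp: divide_simps)
    then show "z \<in> {z. outer_normal X c k \<bullet> z \<le> outer_normal X c k \<bullet> ?P}"
      by (simp add: inner_diff_right)
  qed
  then have "convex hull (X ` set (corners c)) \<subseteq> {z. outer_normal X c k \<bullet> z \<le> outer_normal X c k \<bullet> ?P}"
    by (rule hull_minimal) (rule convex_halfspace_le)
  then show "outer_normal X c k \<bullet> (x - ?P) \<le> 0"
    using x by (auto simp: inner_diff_right)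
qed

end

theory Submission
  imports Defs
begin

text \<open>
  If the averages come from one polynomial \<open>p\<close>, the interior and exterior states agree with
  \<open>p\<close> at every quadrature point: the dissipation vanishes and the flux reduces to
  \<open>- (w \<bullet> n) p\<close>.  As the moment operator uses the same quadrature, the right-hand side for \<open>V\<close>
  is then the combination, with the coefficients of \<open>p\<close>, of those for the moments.  This linear
  relation is preserved by each stage of the Runge--Kutta step.
\<close>

text \<open>All three stage equations are linear in states and right-hand sides, so they commute
  with \<open>f\<close>. This carries the scalar moment updates over to vectors.\<close>

lemma ssprk3_linear:
  assumes "linear f" "ssprk3 dt u0 u1 u2 u3 L0 L1 L2"
  shows "ssprk3 dt (f u0) (f u1) (f u2) (f u3) (f L0) (f L1) (f L2)"
  using assms(2) by (auto simp: ssprk3_def linear_add[OF assms(1)] linear_scale[OF assms(1)])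

lemma ssprk3_sum:
  assumes "\<And>i. i \<in> I \<Longrightarrow> ssprk3 dt (u0 i) (u1 i) (u2 i) (u3 i) (L0 i) (L1 i) (L2 i)"
  shows "ssprk3 dt (sum u0 I) (sum u1 I) (sum u2 I) (sum u3 I) (sum L0 I) (sum L1 I) (sum L2 I)"
  using assms by (simp add: ssprk3_def scaleR_sum_right flip: sum.distrib)

text \<open>In a fixed cell the combination is a sum of images under the linear maps
  \<open>\<lambda>a. a *\<^sub>R cf s r\<close>. The right-hand sides \<open>K0\<close>,
  \<open>K1\<close>, \<open>K2\<close> are themselves treated as moments.\<close>

lemma ssprk3_moment_integral:
  assumes "\<And>s r. s + r \<le> 2 \<Longrightarrow>
    ssprk3 dt (M0 s r c) (M1 s r c) (M2 s r c) (M3 s r c) (K0 s r c) (K1 s r c) (K2 s r c)"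
  shows "ssprk3 dt (moment_integral cf M0 c) (moment_integral cf M1 c) (moment_integral cf M2 c)
    (moment_integral cf M3 c) (moment_integral cf K0 c) (moment_integral cf K1 c)
    (moment_integral cf K2 c)"
  unfolding moment_integral_def
  by (rule ssprk3_sum) (auto intro!: ssprk3_linear[where f = "\<lambda>a. a *\<^sub>R _"] linear_scaleR_left assms)

lemma cell_average_eq_moment_average:
  assumes "V c = moment_integral cf M c"
  shows "cell_average M V c = moment_average cf M c"
  using assms by (simp add: cell_average_def moment_average_def)

text \<open>Stencils stay inside the mesh, so data polynomial on all cells are polynomial on each
  stencil.\<close>

lemma two_exact_reconstruction:
  assumes "has_stencils Nx Ny St R" "two_exact Nx Ny St R X M" "c \<in> cells Nx Ny"
    and "\<forall>d \<in> cells Nx Ny. U d = moment_average cf M d"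
  shows "R X M U c x = quad_poly cf x"
  using assms unfolding has_stencils_def two_exact_def by blast

lemma geo_flux_mult_vec: "geo_flux U w *v n = - ((w \<bullet> n) *\<^sub>R U)"
  by (simp add: vec_eq_iff geo_flux_def matrix_vector_mult_def inner_vec_def sum_distrib_left
      sum_negf mult_ac)

lemma num_flux_diag: "num_flux w X c k g U U = - ((at_gl w c k g \<bullet> outer_normal X c k) *\<^sub>R U)"
  by (simp add: num_flux_def geo_flux_mult_vec flip: scaleR_add_left scaleR_minus_left)

lemma moment_integral_sum:
  "moment_integral cf (\<lambda>s r c. \<Sum>k\<in>K. F k s r c) c = (\<Sum>k\<in>K. moment_integral cf (F k) c)"
  unfolding moment_integral_def
  by (subst sum.swap) (simp add: scaleR_sum_left case_prod_beta)

text \<open>The factor may vary with the cell, as edge lengths and normals do, but not with the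
  exponents.\<close>

lemma moment_integral_mult:
  "moment_integral cf (\<lambda>s r c. a c * M s r c) c = a c *\<^sub>R moment_integral cf M c"
  by (simp add: moment_integral_def scaleR_sum_right case_prod_beta)

lemma moment_integral_L_moment:
  "moment_integral cf (L_moment w X) c =
     (\<Sum>k = 1..4. edge_length X c k *\<^sub>R
       (\<Sum>g = 1..3. (gl_weight g * (at_gl w c k g \<bullet> outer_normal X c k)) *\<^sub>R
          quad_poly cf (at_gl X c k g)))"
proof -
  \<comment> \<open>The monomial is moved to the end, so that everything independent of
    \<open>s\<close> and \<open>r\<close> can be pulled out and the rest sums to
    \<open>quad_poly\<close>.\<close>
  have L: "L_moment w X = (\<lambda>s r c. \<Sum>k = 1..4. edge_length X c k *
      (\<Sum>g = 1..3. (gl_weight g * (at_gl w c k g \<bullet> outer_normal X c k)) *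
        (at_gl X c k g $ 1 ^ s * at_gl X c k g $ 2 ^ r)))"
    by (simp add: L_moment_def fun_eq_iff mult_ac)
  show ?thesis
    unfolding L moment_integral_sum moment_integral_mult
    by (simp add: moment_integral_def quad_poly_def)
qed

text \<open>The outer minus sign of \<open>L_V\<close> cancels the one in the flux
  \<open>- U \<otimes> w\<close>, leaving the same quadrature sum as for the moments.\<close>

lemma L_V_eq_moment_integral:
  assumes "has_stencils Nx Ny St R" "two_exact Nx Ny St R X M"
    and ext: "consistent_exterior Nx Ny E X M (cell_average M V)"
    and V: "\<forall>d \<in> cells Nx Ny. V d = moment_integral cf M d"
    and c: "c \<in> cells Nx Ny"
  shows "L_V Nx Ny R E w X M V c = moment_integral cf (L_moment w X) c"
proof -
  let ?U = "cell_average M V"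
  have avg: "\<forall>d \<in> cells Nx Ny. ?U d = moment_average cf M d"
    using V by (simp add: cell_average_eq_moment_average)
  note rec = two_exact_reconstruction[OF assms(1,2) _ avg]
  have int: "U_int R X M ?U c k g = quad_poly cf (at_gl X c k g)" for k g
    by (simp add: U_int_def rec c)
  \<comment> \<open>Interior edges use exactness in the neighbouring cell, boundary edges the
    consistency of \<open>E\<close>.\<close>
  have "U_ext Nx Ny R E X M ?U c k g = quad_poly cf (at_gl X c k g)"
    if "k \<in> {1..4}" "g \<in> {1..3}" for k g
    using ext avg c that unfolding U_ext_def consistent_exterior_def by (auto simp: rec)
  then show ?thesis
    unfolding moment_integral_L_moment L_V_def Let_def int
    by (simp add: num_flux_diag sum_negf)
qed

theorem proposition4p4:
  fixes Nx Ny :: nat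
    and x\<^sub>n w :: geometry
    and X :: "real \<Rightarrow> geometry"
    and \<tau> \<Delta>\<tau> :: real
    and M0 M1 M2 M3 :: moments
    and V0 V1 V2 V3 :: "cell \<Rightarrow> real ^ 'm"
    and St :: "cell \<Rightarrow> cell set"
    and R :: "('m :: finite) reconstruction"
    and E :: "'m exterior"
    and cf :: "nat \<Rightarrow> nat \<Rightarrow> real ^ 'm"
  assumes motion: "X = moving_nodes x\<^sub>n w"
    and regular: "\<forall>t \<in> closed_segment \<tau> (\<tau> + \<Delta>\<tau>). regular_mesh Nx Ny (X t)"
    and nonzero: "\<forall>M \<in> {M0, M1, M2, M3}. \<forall>c \<in> cells Nx Ny. M 0 0 c \<noteq> 0"
    and stencils: "has_stencils Nx Ny St R"
    and exact0: "two_exact Nx Ny St R (X \<tau>) M0"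
    and exact1: "two_exact Nx Ny St R (X (\<tau> + \<Delta>\<tau>)) M1"
    and exact2: "two_exact Nx Ny St R (X (\<tau> + \<Delta>\<tau> / 2)) M2"
    and boundary0: "consistent_exterior Nx Ny E (X \<tau>) M0 (cell_average M0 V0)"
    and boundary1: "consistent_exterior Nx Ny E (X (\<tau> + \<Delta>\<tau>)) M1 (cell_average M1 V1)"
    and boundary2: "consistent_exterior Nx Ny E (X (\<tau> + \<Delta>\<tau> / 2)) M2 (cell_average M2 V2)"
    and step_M: "\<forall>c \<in> cells Nx Ny. \<forall>s r. s + r \<le> 2 \<longrightarrow>
      ssprk3 \<Delta>\<tau> (M0 s r c) (M1 s r c) (M2 s r c) (M3 s r c)
        (L_moment w (X \<tau>) s r c)
        (L_moment w (X (\<tau> + \<Delta>\<tau>)) s r c)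
        (L_moment w (X (\<tau> + \<Delta>\<tau> / 2)) s r c)"
    and step_V: "\<forall>c \<in> cells Nx Ny.
      ssprk3 \<Delta>\<tau> (V0 c) (V1 c) (V2 c) (V3 c)
        (L_V Nx Ny R E w (X \<tau>) M0 V0 c)
        (L_V Nx Ny R E w (X (\<tau> + \<Delta>\<tau>)) M1 V1 c)
        (L_V Nx Ny R E w (X (\<tau> + \<Delta>\<tau> / 2)) M2 V2 c)"
    and initial: "\<forall>c \<in> cells Nx Ny. V0 c = moment_integral cf M0 c"
  shows "(\<forall>c \<in> cells Nx Ny. V3 c = moment_integral cf M3 c) \<and>
    (\<forall>c \<in> cells Nx Ny. cell_average M3 V3 c = moment_average cf M3 c) \<and>
    (\<forall>(St' :: cell \<Rightarrow> cell set) (R' :: 'm reconstruction).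
      has_stencils Nx Ny St' R' \<and> two_exact Nx Ny St' R' (X (\<tau> + \<Delta>\<tau>)) M3 \<longrightarrow>
      (\<forall>c \<in> cells Nx Ny. \<forall>x.
        R' (X (\<tau> + \<Delta>\<tau>)) M3 (cell_average M3 V3) c x = quad_poly cf x))"
proof -
  note L = L_V_eq_moment_integral[OF stencils, of _ _ E _ cf _ w]
  have mom: "ssprk3 \<Delta>\<tau> (moment_integral cf M0 c) (moment_integral cf M1 c)
      (moment_integral cf M2 c) (moment_integral cf M3 c)
      (moment_integral cf (L_moment w (X \<tau>)) c)
      (moment_integral cf (L_moment w (X (\<tau> + \<Delta>\<tau>))) c)
      (moment_integral cf (L_moment w (X (\<tau> + \<Delta>\<tau> / 2))) c)"
    if "c \<in> cells Nx Ny" for c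
    using step_M that by (intro ssprk3_moment_integral) blast
  \<comment> \<open>Stages go in order: the relation must hold in all cells at one stage before the
    operator there can be identified for the next.\<close>
  have V1: "\<forall>c \<in> cells Nx Ny. V1 c = moment_integral cf M1 c"
    using step_V mom initial L[OF exact0 boundary0 initial] by (simp add: ssprk3_def)
  have V2: "\<forall>c \<in> cells Nx Ny. V2 c = moment_integral cf M2 c"
  proof
    fix c assume c: "c \<in> cells Nx Ny"
    show "V2 c = moment_integral cf M2 c"
      using bspec[OF step_V c] mom[OF c] bspec[OF initial c] bspec[OF V1 c]
        L[OF exact1 boundary1 V1 c]
      unfolding ssprk3_def by metis
  qed
  have V3: "\<forall>c \<in> cells Nx Ny. V3 c = moment_integral cf M3 c"
  proof
    fix c assume c: "c \<in> cells Nx Ny"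
    show "V3 c = moment_integral cf M3 c"
      using bspec[OF step_V c] mom[OF c] bspec[OF initial c] bspec[OF V2 c]
        L[OF exact2 boundary2 V2 c]
      unfolding ssprk3_def by metis
  qed
  then have avg: "\<forall>c \<in> cells Nx Ny. cell_average M3 V3 c = moment_average cf M3 c"
    by (simp add: cell_average_eq_moment_average)
  \<comment> \<open>The last claim is exactness of \<open>R'\<close> applied to the new averages,
    with its own stencils \<open>St'\<close>.\<close>
  with V3 show ?thesis
    by (blast intro: two_exact_reconstruction)
qed

end
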